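(* For $G\subseteq\mathbb{R}^n$, $f:G\to\mathbb{R}^n$, and functions $V,\tilde V,\hat V:G\to\mathbb{R}_+$, consider the following conditions: (i) There exist $C_1,C_2>0$, $C_3\ge0$, $q>r>0$ such that for all $x\in G$: $C_1\|x\|_2^r\le V(x)\le C_2\|x\|_2^r$ and $\nabla V(x)^Tf(x)\le-C_3\|x\|_2^q$. (ii) There exist $c\ge0$, $\gamma,p,r>0$ such that for all $x\in G$: $\gamma^{-1}\|x\|_2^r\le\tilde V(x)\le\|x\|_2^r$ and $\nabla\tilde V(x)^Tf(x)\le-c\tilde V(x)\|x\|_2^p$. (iii) There exist $k\ge0$, $M,p>0$ such that for all $x\in G$: $M^{-1}\|x\|_2^p\le\hat V(x)\le\|x\|_2^p$ and $\nabla\hat V(x)^Tf(x)\le-k\hat V(x)^2$. Then the following statements hold, where "(a) implies (b) with given constants" means: if some function satisfies (a) with its constants, then there exists a function satisfying (b) with the indicated constants: 1) (i) implies (ii) with $p=q-r$, the same $r$, $\gamma=\frac{C_2}{C_1}$, $c=\frac{C_3}{C_2}$. 2) (ii) implies (i) with $C_1=\frac1\gamma$, $C_2=1$, $C_3=\frac c\gamma$, the same $r$, $q=r+p$. 3) (ii) implies (iii) with the same $p$, $M=\gamma^{\frac pr}$, $k=\frac{cp}r$. 4) (iii) implies (ii) with the same $p$, $r=p$, $\gamma=M$, $c=\frac kM$. 5) (i) implies (iii) with $p=q-r$, $M=\left(\frac{C_2}{C_1}\right)^{\frac qr-1}$, $k=\left(\frac qr-1\right)\frac{C_3}{C_2}$.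 6) (iii) implies (i) with $C_1=\frac1M$, $C_2=1$, $C_3=\frac k{M^2}$, $r=p$, $q=2p$.
   Context: $\mathbb{R}_+=[0,\infty)$; $\|\cdot\|_2$ is the Euclidean norm on $\mathbb{R}^n$. The functions $V,\tilde V,\hat V$ are understood to be differentiable at every point of $G\setminus\{0\}$, and the gradient inequalities are understood at points of $G\setminus\{0\}$. *)

theory Defs
  imports "HOL-Analysis.Analysis"
begin

text \<open>
  The gradient as a vector, from the library relation \<^const>\<open>gderiv\<close>; it is meaningful only
  where \<open>V\<close> is differentiable (see the two lemmas below).
\<close>

definition gradient :: "(real ^ 'n \<Rightarrow> real) \<Rightarrow> real ^ 'n \<Rightarrow> real ^ 'n" where
  "gradient V x = (THE D. GDERIV V x :> D)"

lemma gradient_eqI: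
  assumes "GDERIV V x :> D"
  shows "gradient V x = D"
  unfolding gradient_def
proof (rule the_equality, rule assms)
  fix E assume "GDERIV V x :> E"
  with assms have "(\<lambda>h. inner h E) = (\<lambda>h. inner h D)"
    unfolding gderiv_def by (metis has_derivative_unique)
  then have "\<forall>h. inner h E = inner h D" by meson
  then show "E = D" by (simp only: vector_eq_ldot)
qed

lemma gradient_works:
  assumes "V differentiable (at x)"
  shows "GDERIV V x :> gradient V x"
proof -
  obtain F where F: "(V has_derivative F) (at x)"
    using assms by (auto simp: differentiable_def)
  then interpret linear F by (rule has_derivative_linear)
  have "F = (\<lambda>h. inner h (adjoint F 1))"
    using adjoint_works[OF linear_axioms, of _ 1] by (auto simp: fun_eq_iff)
  with F have "GDERIV V x :> adjoint F 1" unfolding gderiv_def by metis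
  then show ?thesis using gradient_eqI by metis
qed

text \<open>
  In the following conditions a function on \<open>G\<close> is a total function whose values are
  constrained on \<open>G\<close> only. At interior points of \<open>G\<close> differentiability and gradient depend
  only on the restriction to \<open>G\<close>; at other points of \<open>G - {0}\<close> they are those of the total
  function, that is, of an extension beyond \<open>G\<close>. At the origin, the bounds say that the
  function vanishes, since \<open>0 powr r = 0\<close>.
\<close>

definition cond_i ::
  "(real ^ 'n) set \<Rightarrow> (real ^ 'n \<Rightarrow> real ^ 'n) \<Rightarrow> (real ^ 'n \<Rightarrow> real) \<Rightarrow>
   real \<Rightarrow> real \<Rightarrow> real \<Rightarrow> real \<Rightarrow> real \<Rightarrow> bool" where
  "cond_i G f V C1 C2 C3 q r \<longleftrightarrow>
     0 < C1 \<and> 0 < C2 \<and> 0 \<le> C3 \<and> r < q \<and> 0 < r \<and>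
     V \<in> G \<rightarrow> {0..} \<and>
     (\<forall>x\<in>G. C1 * norm x powr r \<le> V x \<and> V x \<le> C2 * norm x powr r) \<and>
     (\<forall>x\<in>G - {0}. V differentiable (at x) \<and>
        gradient V x \<bullet> f x \<le> - C3 * norm x powr q)"

definition cond_ii ::
  "(real ^ 'n) set \<Rightarrow> (real ^ 'n \<Rightarrow> real ^ 'n) \<Rightarrow> (real ^ 'n \<Rightarrow> real) \<Rightarrow>
   real \<Rightarrow> real \<Rightarrow> real \<Rightarrow> real \<Rightarrow> bool" where
  "cond_ii G f V c \<gamma> p r \<longleftrightarrow>
     0 \<le> c \<and> 0 < \<gamma> \<and> 0 < p \<and> 0 < r \<and>
     V \<in> G \<rightarrow> {0..} \<and>
     (\<forall>x\<in>G. inverse \<gamma> * norm x powr r \<le> V x \<and> V x \<le> norm x powr r) \<and>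
     (\<forall>x\<in>G - {0}. V differentiable (at x) \<and>
        gradient V x \<bullet> f x \<le> - c * V x * norm x powr p)"

definition cond_iii ::
  "(real ^ 'n) set \<Rightarrow> (real ^ 'n \<Rightarrow> real ^ 'n) \<Rightarrow> (real ^ 'n \<Rightarrow> real) \<Rightarrow>
   real \<Rightarrow> real \<Rightarrow> real \<Rightarrow> bool" where
  "cond_iii G f V k M p \<longleftrightarrow>
     0 \<le> k \<and> 0 < M \<and> 0 < p \<and>
     V \<in> G \<rightarrow> {0..} \<and>
     (\<forall>x\<in>G. inverse M * norm x powr p \<le> V x \<and> V x \<le> norm x powr p) \<and>
     (\<forall>x\<in>G - {0}. V differentiable (at x) \<and>
        gradient V x \<bullet> f x \<le> - k * (V x)\<^sup>2)"

end

theory Submission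
  imports Defs
begin

text \<open>
  On \<open>G\<close> each of the three conditions compares the function with a power of the norm, so in the
  decay inequality a power of the norm may be traded for a power of the function, at the price of
  one of the comparison constants. The direction of the trade is always the favourable one:
  the right-hand sides are nonpositive, so an upper bound on the function is used to replace a power
  of the norm by the function, and a lower bound to do the converse.

  Four implications are elementary in this sense. From (i) to (ii) the function is divided by
  \<open>C2\<close>, which normalises the upper bound; from (ii) to (i) and from (iii) to (ii) it is left unchanged.
  From (ii) to (iii) the exponents \<open>r\<close> and \<open>p\<close> have to be matched, which the power
  \<open>V powr (p / r)\<close> does: by the chain rule its derivative along \<open>f\<close> is
  \<open>p / r * V powr (p / r - 1)\<close> times that of \<open>V\<close>, so the factor \<open>V\<close> on the right-hand side of (ii)
  turns into \<open>V powr (p / r)\<close>. The power may fail to be differentiable where \<open>V\<close> vanishes, but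
  the lower bound makes \<open>V\<close> positive away from the origin.
  The remaining two implications are compositions, \<open>(i) \<rightarrow> (ii) \<rightarrow> (iii)\<close> and
  \<open>(iii) \<rightarrow> (ii) \<rightarrow> (i)\<close>, whose constants multiply out to the claimed ones.
\<close>

text \<open>
  The chain rule, applied below with \<open>g t = t / C2\<close> and with \<open>g t = t powr (p / r)\<close>.
\<close>

lemma gradient_compose:
  fixes V :: "real ^ 'n \<Rightarrow> real"
  assumes "V differentiable (at x)" and "DERIV g (V x) :> d"
  shows "(\<lambda>y. g (V y)) differentiable (at x)"
    and "gradient (\<lambda>y. g (V y)) x = d *\<^sub>R gradient V x"
proof -
  have D: "GDERIV (\<lambda>y. g (V y)) x :> d *\<^sub>R gradient V x"
    by (rule GDERIV_DERIV_compose[OF gradient_works[OF assms(1)] assms(2)])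
  then show "gradient (\<lambda>y. g (V y)) x = d *\<^sub>R gradient V x"
    by (rule gradient_eqI)
  show "(\<lambda>y. g (V y)) differentiable (at x)"
    using D unfolding gderiv_def differentiable_def by blast
qed

text \<open>
  With the upper bound normalised, \<open>norm x powr q = norm x powr r * norm x powr (q - r)\<close> dominates
  \<open>V x / C2 * norm x powr (q - r)\<close>.
\<close>

lemma cond_i_imp_cond_ii:
  assumes "cond_i G f V C1 C2 C3 q r"
  shows "cond_ii G f (\<lambda>x. V x / C2) (C3 / C2) (C2 / C1) (q - r) r"
proof -
  have pos: "0 < C1" "0 < C2" "0 \<le> C3" "r < q" "0 < r"
    and bnd: "\<And>x. x \<in> G \<Longrightarrow> 0 \<le> V x \<and> C1 * norm x powr r \<le> V x \<and> V x \<le> C2 * norm x powr r"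
    and dif: "\<And>x. x \<in> G - {0} \<Longrightarrow> V differentiable (at x)"
    and dec: "\<And>x. x \<in> G - {0} \<Longrightarrow> gradient V x \<bullet> f x \<le> - C3 * norm x powr q"
    using assms by (auto simp: cond_i_def Pi_iff)
  have "(\<lambda>y. V y / C2) differentiable (at x) \<and>
        gradient (\<lambda>y. V y / C2) x \<bullet> f x \<le> - (C3 / C2) * (V x / C2) * norm x powr (q - r)"
    if x: "x \<in> G - {0}" for x
  proof -
    have D: "DERIV (\<lambda>t. t / C2) (V x) :> 1 / C2"
      using pos by (auto intro!: derivative_eq_intros)
    have "V x / C2 \<le> norm x powr r"
      using bnd[of x] x pos by (simp add: field_simps)
    then have "V x / C2 * norm x powr (q - r) \<le> norm x powr r * norm x powr (q - r)"
      by (intro mult_right_mono) auto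
    also have "\<dots> = norm x powr q"
      by (simp flip: powr_add)
    finally have "C3 / C2 * (V x / C2 * norm x powr (q - r)) \<le> C3 / C2 * norm x powr q"
      using pos by (intro mult_left_mono) auto
    moreover have "(gradient V x \<bullet> f x) / C2 \<le> (- C3 * norm x powr q) / C2"
      using dec[OF x] pos by (intro divide_right_mono) auto
    ultimately show ?thesis
      using gradient_compose[OF dif[OF x] D] by (simp add: mult.assoc)
  qed
  then show ?thesis
    using pos bnd by (auto simp: cond_ii_def Pi_iff field_simps)
qed

text \<open>
  The lower bound turns the factor \<open>V x\<close> of the decay rate into \<open>norm x powr r / \<gamma>\<close>.
\<close>

lemma cond_ii_imp_cond_i:
  assumes "cond_ii G f V c \<gamma> p r"
  shows "cond_i G f V (1 / \<gamma>) 1 (c / \<gamma>) (r + p) r"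
proof -
  have pos: "0 \<le> c" "0 < \<gamma>" "0 < p" "0 < r"
    and bnd: "\<And>x. x \<in> G \<Longrightarrow> 0 \<le> V x \<and> inverse \<gamma> * norm x powr r \<le> V x \<and> V x \<le> norm x powr r"
    and dif: "\<And>x. x \<in> G - {0} \<Longrightarrow> V differentiable (at x)"
    and dec: "\<And>x. x \<in> G - {0} \<Longrightarrow> gradient V x \<bullet> f x \<le> - c * V x * norm x powr p"
    using assms by (auto simp: cond_ii_def Pi_iff)
  have "gradient V x \<bullet> f x \<le> - (c / \<gamma>) * norm x powr (r + p)" if x: "x \<in> G - {0}" for x
  proof -
    have "c * norm x powr p * (inverse \<gamma> * norm x powr r) \<le> c * norm x powr p * V x"
      using bnd[of x] x pos by (intro mult_left_mono) auto
    then show ?thesis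
      using dec[OF x] by (simp add: powr_add field_simps)
  qed
  then show ?thesis
    using pos bnd dif by (auto simp: cond_i_def Pi_iff inverse_eq_divide)
qed

text \<open>
  The exponent \<open>p / r\<close> is the one for which \<open>V powr (p / r)\<close> is comparable to \<open>norm x powr p\<close>. The decay
  rate of (ii) then becomes a multiple of \<open>V powr (p / r) * norm x powr p\<close>, and the upper bound
  completes the square.
\<close>

lemma cond_ii_imp_cond_iii:
  assumes "cond_ii G f V c \<gamma> p r"
  shows "cond_iii G f (\<lambda>x. V x powr (p / r)) (c * p / r) (\<gamma> powr (p / r)) p"
proof -
  have pos: "0 \<le> c" "0 < \<gamma>" "0 < p" "0 < r"
    and bnd: "\<And>x. x \<in> G \<Longrightarrow> 0 \<le> V x \<and> inverse \<gamma> * norm x powr r \<le> V x \<and> V x \<le> norm x powr r"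
    and dif: "\<And>x. x \<in> G - {0} \<Longrightarrow> V differentiable (at x)"
    and dec: "\<And>x. x \<in> G - {0} \<Longrightarrow> gradient V x \<bullet> f x \<le> - c * V x * norm x powr p"
    using assms by (auto simp: cond_ii_def Pi_iff)
  have upper: "V x powr (p / r) \<le> norm x powr p" if "x \<in> G" for x
  proof -
    have "V x powr (p / r) \<le> (norm x powr r) powr (p / r)"
      using bnd[OF that] pos by (intro powr_mono2) auto
    then show ?thesis
      using pos by (simp add: powr_powr)
  qed
  have lower: "inverse (\<gamma> powr (p / r)) * norm x powr p \<le> V x powr (p / r)" if "x \<in> G" for x
  proof -
    have "(inverse \<gamma> * norm x powr r) powr (p / r) \<le> V x powr (p / r)"
      using bnd[OF that] pos by (intro powr_mono2) auto
    then show ?thesis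
      using pos by (simp add: powr_mult powr_powr inverse_powr)
  qed
  have "(\<lambda>y. V y powr (p / r)) differentiable (at x) \<and>
        gradient (\<lambda>y. V y powr (p / r)) x \<bullet> f x \<le> - (c * p / r) * (V x powr (p / r))\<^sup>2"
    if x: "x \<in> G - {0}" for x
  proof -
    \<comment> \<open>Away from the origin \<open>V\<close> is positive, so the power is differentiable at \<open>V x\<close>.\<close>
    have "0 < inverse \<gamma> * norm x powr r"
      using x pos by simp
    then have Vpos: "0 < V x"
      using bnd[of x] x by auto
    have D: "DERIV (\<lambda>t. t powr (p / r)) (V x) :> p / r * V x powr (p / r - 1)"
      by (rule has_real_derivative_powr[OF Vpos])
    have split: "V x powr (p / r - 1) * V x = V x powr (p / r)"
      using Vpos by (simp add: powr_diff)
    have "p / r * V x powr (p / r - 1) * (gradient V x \<bullet> f x)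
        \<le> p / r * V x powr (p / r - 1) * (- c * V x * norm x powr p)"
      using dec[OF x] pos by (intro mult_left_mono) auto
    also have "\<dots> = - (c * p / r) * ((V x powr (p / r - 1) * V x) * norm x powr p)"
      by simp
    also have "\<dots> = - (c * p / r * (V x powr (p / r) * norm x powr p))"
      unfolding split by simp
    also have "\<dots> \<le> - (c * p / r * (V x powr (p / r) * V x powr (p / r)))"
      using upper[of x] x pos by (intro le_imp_neg_le mult_left_mono) auto
    finally show ?thesis
      using gradient_compose[OF dif[OF x] D] by (simp add: power2_eq_square)
  qed
  then show ?thesis
    using pos upper lower by (auto simp: cond_iii_def)
qed

text \<open>
  Of the two factors of \<open>(V x)\<^sup>2\<close>, one is kept and the other is estimated by the lower bound.
\<close>

lemma cond_iii_imp_cond_ii: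
  assumes "cond_iii G f V k M p"
  shows "cond_ii G f V (k / M) M p p"
proof -
  have pos: "0 \<le> k" "0 < M" "0 < p"
    and bnd: "\<And>x. x \<in> G \<Longrightarrow> 0 \<le> V x \<and> inverse M * norm x powr p \<le> V x \<and> V x \<le> norm x powr p"
    and dif: "\<And>x. x \<in> G - {0} \<Longrightarrow> V differentiable (at x)"
    and dec: "\<And>x. x \<in> G - {0} \<Longrightarrow> gradient V x \<bullet> f x \<le> - k * (V x)\<^sup>2"
    using assms by (auto simp: cond_iii_def Pi_iff)
  have "gradient V x \<bullet> f x \<le> - (k / M) * V x * norm x powr p" if x: "x \<in> G - {0}" for x
  proof -
    have "k * V x * (inverse M * norm x powr p) \<le> k * V x * V x"
      using bnd[of x] x pos by (intro mult_left_mono) auto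
    then show ?thesis
      using dec[OF x] by (simp add: power2_eq_square field_simps)
  qed
  then show ?thesis
    using pos bnd dif by (auto simp: cond_ii_def)
qed

lemma cond_i_imp_cond_iii:
  assumes "cond_i G f V C1 C2 C3 q r"
  shows "cond_iii G f (\<lambda>x. (V x / C2) powr ((q - r) / r))
           ((q / r - 1) * (C3 / C2)) ((C2 / C1) powr (q / r - 1)) (q - r)"
proof -
  have "0 < r"
    using assms by (simp add: cond_i_def)
  then have e: "(q - r) / r = q / r - 1"
    by (simp add: diff_divide_distrib)
  have k: "C3 / C2 * (q - r) / r = (q / r - 1) * (C3 / C2)"
    by (simp flip: e add: mult.commute)
  show ?thesis
    using cond_ii_imp_cond_iii[OF cond_i_imp_cond_ii[OF assms]] unfolding k e .
qed

lemma cond_iii_imp_cond_i: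
  assumes "cond_iii G f V k M p"
  shows "cond_i G f V (1 / M) 1 (k / M\<^sup>2) (2 * p) p"
proof -
  have "k / M / M = k / M\<^sup>2"
    by (simp add: power2_eq_square)
  then show ?thesis
    using cond_ii_imp_cond_i[OF cond_iii_imp_cond_ii[OF assms]] by (simp only: mult_2)
qed

theorem lemma26:
  fixes G :: "(real ^ 'n) set" and f :: "real ^ 'n \<Rightarrow> real ^ 'n"
  shows
    "(\<forall>C1 C2 C3 q r. (\<exists>V. cond_i G f V C1 C2 C3 q r) \<longrightarrow>
        (\<exists>V'. cond_ii G f V' (C3 / C2) (C2 / C1) (q - r) r)) \<and>
     (\<forall>c \<gamma> p r. (\<exists>V'. cond_ii G f V' c \<gamma> p r) \<longrightarrow>
        (\<exists>V. cond_i G f V (1 / \<gamma>) 1 (c / \<gamma>) (r + p) r)) \<and>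
     (\<forall>c \<gamma> p r. (\<exists>V'. cond_ii G f V' c \<gamma> p r) \<longrightarrow>
        (\<exists>V''. cond_iii G f V'' (c * p / r) (\<gamma> powr (p / r)) p)) \<and>
     (\<forall>k M p. (\<exists>V''. cond_iii G f V'' k M p) \<longrightarrow>
        (\<exists>V'. cond_ii G f V' (k / M) M p p)) \<and>
     (\<forall>C1 C2 C3 q r. (\<exists>V. cond_i G f V C1 C2 C3 q r) \<longrightarrow>
        (\<exists>V''. cond_iii G f V'' ((q / r - 1) * (C3 / C2)) ((C2 / C1) powr (q / r - 1)) (q - r))) \<and>
     (\<forall>k M p. (\<exists>V''. cond_iii G f V'' k M p) \<longrightarrow>
        (\<exists>V. cond_i G f V (1 / M) 1 (k / M\<^sup>2) (2 * p) p))"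
proof (intro conjI allI impI; elim exE)
qed (rule exI, (erule cond_i_imp_cond_ii | erule cond_ii_imp_cond_i | erule cond_ii_imp_cond_iii
      | erule cond_iii_imp_cond_ii | erule cond_i_imp_cond_iii | erule cond_iii_imp_cond_i))+

end
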